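(* For every integer $d\ge 3$ there is a constant $c=c(d)$ with the following property. If $S\subset\mathbb{R}^d$ is a set of $n$ points such that no $d$ of them lie on a hyperplane (affine flat) of dimension $d-2$, then $S$ determines at least $\binom{n}{d+1}-c\,n^d$ affine simplexes, i.e. at least this many subsets of $S$ are affine simplexes.
   Context: Here "hyperplane of dimension $m$" in $\mathbb{R}^d$ means an $m$-dimensional affine subspace (for $m=d$, the whole space). A set $A$ of $k\ge 3$ points in $\mathbb{R}^d$ is called an affine simplex if $A$ is contained in some $(k-2)$-dimensional affine subspace, but no nonempty proper subset $A'\subsetneq A$ is contained in an affine subspace of dimension $|A'|-2$; equivalently, $A$ is affinely dependent but each of its proper subsets is affinely independent. *)

theory Defs
  imports "HOL-Analysis.Analysis"
begin

text \<open>The dimension \<open>m\<close> is an integer, following \<^const>\<open>aff_dim\<close>. The only flat of dimension \<open>-1\<close> is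
  the empty set, so no nonempty set lies on a flat of dimension \<open>-1\<close>.\<close>

definition on_flat :: "int \<Rightarrow> 'a::euclidean_space set \<Rightarrow> bool" where
  "on_flat m A \<longleftrightarrow> (\<exists>H. affine H \<and> aff_dim H = m \<and> A \<subseteq> H)"

definition affine_simplex :: "'a::euclidean_space set \<Rightarrow> bool" where
  "affine_simplex A \<longleftrightarrow>
     finite A \<and> card A \<ge> 3 \<and> on_flat (int (card A) - 2) A \<and>
     (\<forall>B. B \<noteq> {} \<and> B \<subset> A \<longrightarrow> \<not> on_flat (int (card B) - 2) B)"

lemma on_flat_imp_affine_dependent:
  assumes "on_flat (int (card A) - 2) A"
  shows "affine_dependent A"
proof (rule ccontr)
  assume "\<not> affine_dependent A"
  then have "aff_dim A = int (card A) - 1"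
    using affine_independent_iff_card by blast
  moreover obtain H where "A \<subseteq> H" "aff_dim H = int (card A) - 2"
    using assms unfolding on_flat_def by blast
  ultimately show False
    using aff_dim_subset[of A H] by simp
qed

lemma minimal_affine_dependent_on_flat:
  assumes "finite A" and dep: "affine_dependent A"
    and min: "\<And>B. B \<subset> A \<Longrightarrow> \<not> affine_dependent B"
  shows "on_flat (int (card A) - 2) A"
proof -
  obtain x where x: "x \<in> A" "x \<in> affine hull (A - {x})"
    using dep unfolding affine_dependent_def by blast
  have "\<not> affine_dependent (A - {x})"
    using min x(1) by blast
  then have "aff_dim (A - {x}) = int (card (A - {x})) - 1"
    using affine_independent_iff_card by blast
  moreover have "card (A - {x}) = card A - 1" and "card A \<ge> 1"
    using x(1) assms(1) by (auto simp: Suc_le_eq card_gt_0_iff)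
  moreover have "aff_dim A = aff_dim (A - {x})"
    using x aff_dim_insert[of x "A - {x}"] by (simp add: insert_absorb)
  ultimately have "aff_dim (affine hull A) = int (card A) - 2"
    by (simp add: aff_dim_affine_hull)
  then show ?thesis
    unfolding on_flat_def by (meson affine_affine_hull hull_subset)
qed

lemma affine_simplex_iff_minimal_affine_dependent:
  "affine_simplex A \<longleftrightarrow>
     finite A \<and> card A \<ge> 3 \<and> affine_dependent A \<and> (\<forall>B. B \<subset> A \<longrightarrow> \<not> affine_dependent B)"
proof
  assume L: "affine_simplex A"
  then have fin: "finite A"
    by (simp add: affine_simplex_def)
  have indep: "\<not> affine_dependent B" if "B \<subset> A" for B
    using that
  proof (induction "card B" arbitrary: B rule: less_induct)
    case less
    have finB: "finite B"
      using less.prems fin finite_subset by blast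
    show ?case
    proof
      assume dep: "affine_dependent B"
      have "\<not> affine_dependent C" if "C \<subset> B" for C
        using less that finB by (meson psubset_card_mono psubset_trans)
      then have "on_flat (int (card B) - 2) B"
        using minimal_affine_dependent_on_flat finB dep by blast
      moreover have "B \<noteq> {}"
        using dep unfolding affine_dependent_def by blast
      ultimately show False
        using L less.prems unfolding affine_simplex_def by blast
    qed
  qed
  with L show "finite A \<and> card A \<ge> 3 \<and> affine_dependent A \<and>
      (\<forall>B. B \<subset> A \<longrightarrow> \<not> affine_dependent B)"
    using on_flat_imp_affine_dependent unfolding affine_simplex_def by blast
next
  assume "finite A \<and> card A \<ge> 3 \<and> affine_dependent A \<and>
      (\<forall>B. B \<subset> A \<longrightarrow> \<not> affine_dependent B)"
  then show "affine_simplex A"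
    unfolding affine_simplex_def
    using on_flat_imp_affine_dependent minimal_affine_dependent_on_flat by blast
qed

end

theory Submission
  imports Defs
begin

text \<open>Call a dependent set of \<open>d + 1\<close> points coplanar. Since every \<open>d\<close> points of \<open>S\<close> are affinely
  independent, an affine simplex of \<open>S\<close> is either a coplanar set of \<open>d + 1\<close> points or a set of \<open>d + 2\<close>
  points without a coplanar subset of \<open>d + 1\<close> points. Fix a small \<open>e > 0\<close> depending only on \<open>d\<close>; there
  are two cases.

  If every hyperplane spanned by \<open>S\<close> contains at most \<open>e n\<close> points of \<open>S\<close>, then coplanar sets are rare:
  they are obtained by adding to \<open>d\<close> points a point of their hyperplane, so at most \<open>e n\<^sup>d\<^sup>+\<^sup>2\<close> sets of
  \<open>d + 2\<close> points contain one. Hence a fixed proportion of all \<open>d + 2\<close>-subsets are simplexes, which for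
  large \<open>n\<close> is far more than the number of \<open>d + 1\<close>-subsets (\<open>card_affine_simplexes_sparse\<close>).

  Otherwise some hyperplane contains \<open>m > e n\<close> points and misses the other \<open>k = n - m\<close>. All
  \<open>d + 1\<close>-subsets of the \<open>m\<close> points are simplexes, which falls short of \<open>n choose (d + 1)\<close> by at most
  \<open>k n\<^sup>d\<close>. Each pair of missed points makes up for a part of this: it forms a simplex with all but
  \<open>m\<^sup>d\<^sup>-\<^sup>1\<close> of the \<open>d\<close>-subsets of the \<open>m\<close> points (\<open>card_bad_completions\<close>), hence, for large \<open>n\<close>,
  with at least a fixed multiple of \<open>n\<^sup>d\<close> of them. The gain is quadratic in \<open>k\<close> and the loss linear, so the gain wins
  once \<open>k\<close> exceeds a constant, and for smaller \<open>k\<close> the loss is \<open>O(n\<^sup>d)\<close> (\<open>rich_count_ge\<close>).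

  Small \<open>n\<close> is absorbed by the choice of the constant.\<close>

section \<open>Points with every \<open>d\<close> of them affinely independent\<close>

text \<open>Including the subsets with fewer than \<open>d\<close> points makes the predicate imply that dependent subsets
  are large also when \<open>S\<close> itself has fewer than \<open>d\<close> points.\<close>

definition almost_general :: "'a::euclidean_space set \<Rightarrow> bool" where
  "almost_general S \<longleftrightarrow> (\<forall>T. finite T \<and> T \<subseteq> S \<and> card T \<le> DIM('a) \<longrightarrow> \<not> affine_dependent T)"

lemma almost_generalD:
  fixes S :: "'a::euclidean_space set"
  assumes "almost_general S" "finite T" "T \<subseteq> S" "card T \<le> DIM('a)"
  shows "\<not> affine_dependent T"
  using assms unfolding almost_general_def by blast

text \<open>A dependent set of \<open>d\<close> points may span a flat of dimension less than \<open>d - 2\<close>, whereas the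
  predicate asks for a flat of the exact dimension; enlarging the span one point at a time closes
  this gap.\<close>

lemma on_flat_of_aff_dim_le:
  fixes T :: "'a::euclidean_space set"
  assumes "aff_dim T \<le> m" and "m \<le> int DIM('a)"
  shows "on_flat m T"
  using assms
proof (induction m rule: int_ge_induct)
  case base
  have "aff_dim (affine hull T) = aff_dim T"
    by (simp add: aff_dim_affine_hull)
  then show ?case
    unfolding on_flat_def by (intro exI[of _ "affine hull T"]) (simp add: hull_subset)
next
  case (step m)
  then obtain H where H: "affine H" "aff_dim H = m" "T \<subseteq> H"
    unfolding on_flat_def by auto
  have "H \<noteq> UNIV"
    using H(2) step.prems by auto
  then obtain x where x: "x \<notin> H" by blast
  with H(1) have "x \<notin> affine hull H"
    by (simp add: hull_same)
  then have "aff_dim (affine hull insert x H) = m + 1"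
    by (simp add: aff_dim_affine_hull aff_dim_insert H(2))
  moreover have "T \<subseteq> affine hull insert x H"
    using H(3) by (meson hull_subset subset_insertI subset_trans)
  ultimately show ?case
    unfolding on_flat_def by (intro exI[of _ "affine hull insert x H"]) simp
qed

lemma affine_independent_of_not_on_flat:
  fixes T :: "'a::euclidean_space set"
  assumes "finite T" "card T \<le> DIM('a)" and "\<not> on_flat (int (card T) - 2) T"
  shows "\<not> affine_dependent T"
proof
  assume "affine_dependent T"
  then have "aff_dim T \<noteq> int (card T) - 1"
    using assms(1) affine_independent_iff_card by blast
  moreover have "aff_dim T \<le> int (card T) - 1"
    using assms(1) aff_dim_le_card by blast
  ultimately have "aff_dim T \<le> int (card T) - 2" by simp
  then show False
    using on_flat_of_aff_dim_le assms(2,3) by fastforce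
qed

lemma almost_general_of_not_on_flat:
  fixes S :: "'a::euclidean_space set"
  assumes fin: "finite S" and large: "DIM('a) \<le> card S"
    and flat: "\<And>T. T \<subseteq> S \<Longrightarrow> card T = DIM('a) \<Longrightarrow> \<not> on_flat (int DIM('a) - 2) T"
  shows "almost_general S"
  unfolding almost_general_def
proof (intro allI impI, elim conjE)
  fix T assume T: "finite T" "T \<subseteq> S" "card T \<le> DIM('a)"
  obtain U where U: "T \<subseteq> U" "U \<subseteq> S" "card U = DIM('a)"
    using exists_subset_between[OF T(3) large T(2) fin] by blast
  have "\<not> affine_dependent U"
    using affine_independent_of_not_on_flat[of U] U flat[of U] fin finite_subset by fastforce
  then show "\<not> affine_dependent T"
    using U(1) affine_independent_subset by blast
qed

lemma affine_simplex_of_card_Suc_DIM: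
  fixes S :: "'a::euclidean_space set"
  assumes "almost_general S" "T \<subseteq> S" "card T = DIM('a) + 1" "affine_dependent T"
    and "DIM('a) \<ge> 2"
  shows "affine_simplex T"
proof -
  have fin: "finite T"
    using assms(3) card_ge_0_finite by force
  have "\<not> affine_dependent B" if "B \<subset> T" for B
  proof -
    have "card B < card T" using that fin psubset_card_mono by blast
    then show ?thesis
      using almost_generalD[OF assms(1), of B] that assms(2,3) fin finite_subset
      by (metis Suc_eq_plus1 less_Suc_eq_le order_trans psubset_imp_subset)
  qed
  then show ?thesis
    unfolding affine_simplex_iff_minimal_affine_dependent using fin assms by simp
qed

text \<open>Any \<open>d + 2\<close> points are dependent, and each proper subset lies in one of size \<open>d + 1\<close>.\<close>

lemma affine_simplex_of_card_DIM_plus_2: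
  fixes T :: "'a::euclidean_space set"
  assumes "card T = DIM('a) + 2"
    and indep: "\<And>x. x \<in> T \<Longrightarrow> \<not> affine_dependent (T - {x})"
  shows "affine_simplex T"
proof -
  have fin: "finite T"
    using assms(1) card_ge_0_finite by force
  have "\<not> affine_dependent B" if B: "B \<subset> T" for B
  proof -
    obtain x where "x \<in> T" "B \<subseteq> T - {x}" using B by blast
    then show ?thesis using indep affine_independent_subset by blast
  qed
  moreover have "affine_dependent T"
    using affine_dependent_biggerset[OF fin] assms(1) by simp
  moreover have "card T \<ge> 3"
    using assms(1) DIM_positive[where 'a='a] by linarith
  ultimately show ?thesis
    unfolding affine_simplex_iff_minimal_affine_dependent using fin by simp
qed

section \<open>No rich hyperplane\<close>

lemma binomial_le_power: "n choose k \<le> n ^ k"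
  by (cases "k \<le> n") (simp_all add: binomial_le_pow binomial_eq_0)

text \<open>Bad configurations are bounded by counting the choices that build them: first \<open>x\<close>, then one of at
  most \<open>b\<close> elements of \<open>R x\<close>.\<close>

lemma card_le_of_family_cover:
  assumes "finite D" "\<And>x. x \<in> D \<Longrightarrow> finite (R x)"
    and "X \<subseteq> (\<Union>x\<in>D. f x ` R x)"
    and "\<And>x. x \<in> D \<Longrightarrow> real (card (R x)) \<le> b"
  shows "real (card X) \<le> real (card D) * b"
proof -
  have "card X \<le> card (\<Union>x\<in>D. f x ` R x)"
    using assms(1-3) by (intro card_mono) auto
  also have "\<dots> \<le> (\<Sum>x\<in>D. card (f x ` R x))"
    using assms(1) by (rule card_UN_le)
  also have "\<dots> \<le> (\<Sum>x\<in>D. card (R x))"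
    using assms(2) by (intro sum_mono card_image_le)
  finally have "real (card X) \<le> (\<Sum>x\<in>D. real (card (R x)))"
    by (metis of_nat_le_iff of_nat_sum)
  also have "\<dots> \<le> (\<Sum>x\<in>D. b)"
    using assms(4) by (rule sum_mono)
  finally show ?thesis by simp
qed

text \<open>A \<open>d + 2\<close>-subset that is no simplex has the form \<open>D \<union> {y, x}\<close> with \<open>D\<close> of size \<open>d\<close> and \<open>y\<close> in
  the affine hull of \<open>D\<close>: there are at most \<open>n\<^sup>d\<close> choices for \<open>D\<close>, then at most \<open>e n\<close> for \<open>y\<close> and \<open>n\<close>
  for \<open>x\<close>.\<close>

lemma card_affine_simplexes_sparse:
  fixes S :: "'a::euclidean_space set"
  assumes fin: "finite S" and n: "card S = n"
    and sparse: "\<And>D. D \<subseteq> S \<Longrightarrow> card D = DIM('a) \<Longrightarrow>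
                   real (card (S \<inter> affine hull D)) \<le> e * real n"
    and e: "0 \<le> e"
  shows "real (card {A. A \<subseteq> S \<and> affine_simplex A})
           \<ge> real (n choose (DIM('a) + 2)) - e * real n ^ (DIM('a) + 2)"
proof -
  let ?d = "DIM('a)"
  define X where "X = {A. A \<subseteq> S \<and> card A = ?d + 2}"
  define bad where "bad = {A \<in> X. \<exists>x\<in>A. affine_dependent (A - {x})}"
  define \<D> where "\<D> = {D. D \<subseteq> S \<and> card D = ?d}"
  have finX: "finite X" and fin\<D>: "finite \<D>"
    using fin by (auto simp: X_def \<D>_def)
  have "bad \<subseteq> (\<Union>D\<in>\<D>. (\<lambda>(y, x). insert x (insert y D)) ` ((S \<inter> affine hull D) \<times> S))"
  proof
    fix A assume "A \<in> bad"
    then obtain x where A: "A \<subseteq> S" "card A = ?d + 2" "x \<in> A" "affine_dependent (A - {x})"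
      unfolding bad_def X_def by blast
    then obtain y where y: "y \<in> A - {x}" "y \<in> affine hull (A - {x} - {y})"
      unfolding affine_dependent_def by blast
    let ?D = "A - {x} - {y}"
    have "finite A" using A(1) fin finite_subset by blast
    then have "?D \<in> \<D>"
      unfolding \<D>_def using A(1-3) y(1) by (auto simp: card_Diff_singleton)
    moreover have "A = insert x (insert y ?D)" using A(3) y(1) by blast
    moreover have "(y, x) \<in> (S \<inter> affine hull ?D) \<times> S" using A(1,3) y by blast
    ultimately show "A \<in> (\<Union>D\<in>\<D>. (\<lambda>(y, x). insert x (insert y D)) ` ((S \<inter> affine hull D) \<times> S))"
      by (intro UN_I[of ?D] image_eqI[of _ _ "(y, x)"]) auto
  qed
  moreover have "real (card ((S \<inter> affine hull D) \<times> S)) \<le> e * real n * real n" if "D \<in> \<D>" for D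
  proof -
    have "real (card (S \<inter> affine hull D)) * real n \<le> (e * real n) * real n"
      using sparse that by (intro mult_right_mono) (auto simp: \<D>_def)
    then show ?thesis using n by (simp add: card_cartesian_product)
  qed
  ultimately have "real (card bad) \<le> real (card \<D>) * (e * real n * real n)"
    using fin fin\<D> by (intro card_le_of_family_cover) auto
  also have "card \<D> = n choose ?d"
    unfolding \<D>_def using n_subsets[OF fin] n by simp
  also have "real (n choose ?d) * (e * real n * real n) \<le> real n ^ ?d * (e * real n * real n)"
    using e binomial_le_power[of n ?d]
    by (intro mult_right_mono) (auto simp flip: of_nat_power)
  also have "\<dots> = e * real n ^ (?d + 2)"
    by (simp add: power_add power2_eq_square)
  finally have bad: "real (card bad) \<le> e * real n ^ (?d + 2)" .
  have "X - bad \<subseteq> {A. A \<subseteq> S \<and> affine_simplex A}"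
    unfolding X_def bad_def using affine_simplex_of_card_DIM_plus_2 by blast
  moreover have "finite {A. A \<subseteq> S \<and> affine_simplex A}" using fin by simp
  ultimately have "card (X - bad) \<le> card {A. A \<subseteq> S \<and> affine_simplex A}"
    by (rule card_mono[rotated])
  moreover have "card X = n choose (?d + 2)"
    unfolding X_def using n_subsets[OF fin] n by simp
  moreover have "bad \<subseteq> X" unfolding bad_def by blast
  then have "card X \<le> card (X - bad) + card bad"
    using finX by (metis card_Un_le Un_Diff_cancel2 Un_absorb2)
  ultimately show ?thesis using bad by linarith
qed

section \<open>A rich hyperplane\<close>

text \<open>If \<open>y \<noteq> y'\<close>, then \<open>E \<union> {y, y'}\<close> consists of \<open>d\<close> independent points inside the hyperplane
  spanned by \<open>E \<union> P\<close>, so it spans that hyperplane. But it lies in \<open>F\<close>, and \<open>P\<close> does not.\<close>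

lemma affine_hull_Int_hyperplane_at_most_one:
  fixes S :: "'a::euclidean_space set"
  assumes gen: "almost_general S" and F: "affine F"
    and E: "finite E" "E \<subseteq> S \<inter> F" "card E + 2 = DIM('a)"
    and P: "P \<subseteq> S - F" "card P = 2"
    and y: "y \<in> S \<inter> F - E" "y \<in> affine hull (E \<union> P)"
    and y': "y' \<in> S \<inter> F - E" "y' \<in> affine hull (E \<union> P)"
  shows "y = y'"
proof (rule ccontr)
  assume ne: "y \<noteq> y'"
  let ?Y = "insert y (insert y' E)" and ?Z = "E \<union> P"
  have finP: "finite P" using P(2) card_ge_0_finite by force
  have "E \<inter> P = {}" using E(2) P(1) by blast
  then have cZ: "card ?Z = DIM('a)" using E P finP by (simp add: card_Un_disjoint)
  have cY: "card ?Y = DIM('a)" using E(1,3) y(1) y'(1) ne by simp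
  have "\<not> affine_dependent ?Y"
    using almost_generalD[OF gen, of ?Y] E y(1) y'(1) cY by simp
  moreover have "\<not> affine_dependent ?Z"
    using almost_generalD[OF gen, of ?Z] E P(1) finP cZ by auto
  ultimately have dims: "aff_dim (affine hull ?Y) = aff_dim (affine hull ?Z)"
    using cY cZ by (simp add: affine_independent_iff_card)
  have "?Y \<subseteq> affine hull ?Z"
    using y(2) y'(2) hull_subset[of ?Z affine] by blast
  then have "affine hull ?Y \<subseteq> affine hull ?Z"
    by (simp add: hull_minimal)
  then have "affine hull ?Y = affine hull ?Z"
    using dims by (intro affine_dim_equal) auto
  moreover have "affine hull ?Y \<subseteq> F"
    using F E(2) y(1) y'(1) by (intro hull_minimal) auto
  ultimately have "P \<subseteq> F"
    using hull_subset[of ?Z affine] by blast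
  then have "P = {}" using P(1) by blast
  then show False using P(2) by simp
qed

text \<open>If \<open>D \<union> P\<close> is no simplex, then omitting some point \<open>x\<close> leaves \<open>d + 1\<close> dependent points. This \<open>x\<close>
  is not in \<open>P\<close>, because the \<open>d\<close> points of \<open>D\<close> together with a point off \<open>F\<close> are independent. So
  \<open>D = E \<union> {y, x}\<close> where \<open>E\<close> has size \<open>d - 2\<close> and \<open>y\<close> is determined by \<open>E\<close>, being in the span of
  \<open>E \<union> P\<close>. Only \<open>d - 1\<close> of the points of \<open>D\<close> are free.\<close>

lemma card_bad_completions:
  fixes S :: "'a::euclidean_space set"
  assumes fin: "finite S" and gen: "almost_general S" and F: "affine F" and d: "DIM('a) \<ge> 2"
    and P: "P \<subseteq> S - F" "card P = 2"
    and m: "card (S \<inter> F) = m"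
  shows "real (card {D. D \<subseteq> S \<inter> F \<and> card D = DIM('a) \<and> \<not> affine_simplex (D \<union> P)})
           \<le> real m ^ (DIM('a) - 1)" (is "real (card ?bad) \<le> _")
proof -
  let ?H = "S \<inter> F"
  define \<E> where "\<E> = {E. E \<subseteq> ?H \<and> card E = DIM('a) - 2}"
  define Y where "Y E = {y \<in> ?H - E. y \<in> affine hull (E \<union> P)}" for E
  have finH: "finite ?H" using fin by simp
  have fin\<E>: "finite \<E>"
    unfolding \<E>_def using finH by (rule finite_subset[rotated, OF finite_Pow_iff[THEN iffD2]]) auto
  have finY: "finite (Y E)" for E unfolding Y_def using finH by (rule finite_subset[rotated]) blast
  have finP: "finite P" using P(2) card_ge_0_finite by force
  have cardY: "card (Y E) \<le> 1" if "E \<in> \<E>" for E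
  proof -
    have "finite E" "E \<subseteq> ?H" "card E + 2 = DIM('a)"
      using that d finite_subset[OF _ finH] by (auto simp: \<E>_def)
    then have "y = y'" if "y \<in> Y E" "y' \<in> Y E" for y y'
      using affine_hull_Int_hyperplane_at_most_one[OF gen F _ _ _ P] that
      unfolding Y_def by blast
    then show ?thesis using finY by (metis One_nat_def card_le_Suc0_iff_eq)
  qed
  have "?bad \<subseteq> (\<Union>E\<in>\<E>. (\<lambda>(y, x). insert x (insert y E)) ` (Y E \<times> ?H))"
  proof
    fix D assume "D \<in> ?bad"
    then have D: "D \<subseteq> ?H" "card D = DIM('a)" "\<not> affine_simplex (D \<union> P)" by auto
    have finD: "finite D" using D(1) finH finite_subset by blast
    have DP: "D \<inter> P = {}" using D(1) P(1) by blast
    have "card (D \<union> P) = DIM('a) + 2"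
      using D(2) P(2) finD finP DP by (simp add: card_Un_disjoint)
    then obtain x where x: "x \<in> D \<union> P" "affine_dependent (D \<union> P - {x})"
      using D(3) affine_simplex_of_card_DIM_plus_2 by blast
    have indepD: "\<not> affine_dependent D"
      using almost_generalD[OF gen finD] D by auto
    have "x \<notin> P"
    proof
      assume "x \<in> P"
      then have "card (P - {x}) = 1" using P(2) by simp
      then obtain p where p: "P - {x} = {p}" by (rule card_1_singletonE)
      have "p \<notin> F" using p P(1) by blast
      moreover have "affine hull D \<subseteq> F" using D(1) F by (intro hull_minimal) auto
      ultimately have "\<not> affine_dependent (insert p D)"
        using indepD affine_independent_insert by blast
      moreover have "D \<union> P - {x} = insert p D" using p \<open>x \<in> P\<close> DP by blast
      ultimately show False using x(2) by simp
    qed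
    then have xD: "x \<in> D" using x(1) by blast
    have "card (D - {x}) \<noteq> 0" using D(2) d finD xD by simp
    then have "D - {x} \<noteq> {}" by force
    then obtain y where y: "y \<in> D - {x}" by blast
    let ?E = "D - {x} - {y}"
    have cE: "card ?E = DIM('a) - 2" using D(2) finD xD y by simp
    have "card (?E \<union> P) \<le> DIM('a)"
      using card_Un_le[of ?E P] cE P(2) d by linarith
    then have "\<not> affine_dependent (?E \<union> P)"
      using almost_generalD[OF gen, of "?E \<union> P"] finD finP D(1) P(1) by blast
    moreover have "D \<union> P - {x} = insert y (?E \<union> P)"
      using y \<open>x \<notin> P\<close> by blast
    ultimately have "y \<in> affine hull (?E \<union> P)"
      using x(2) affine_independent_insert by metis
    then have "y \<in> Y ?E" using y D(1) unfolding Y_def by blast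
    moreover have "?E \<in> \<E>" using cE D(1) unfolding \<E>_def by blast
    moreover have "D = insert x (insert y ?E)" using xD y by blast
    moreover have "x \<in> ?H" using xD D(1) by blast
    ultimately show "D \<in> (\<Union>E\<in>\<E>. (\<lambda>(y, x). insert x (insert y E)) ` (Y E \<times> ?H))"
      by (intro UN_I[of ?E] image_eqI[of _ _ "(y, x)"]) auto
  qed
  moreover have "real (card (Y E \<times> ?H)) \<le> real m" if "E \<in> \<E>" for E
    using mult_right_mono[OF cardY[OF that], of m] m
    by (simp add: card_cartesian_product flip: of_nat_mult)
  ultimately have "real (card ?bad) \<le> real (card \<E>) * real m"
    using finY finH by (intro card_le_of_family_cover[OF fin\<E>, of "\<lambda>E. Y E \<times> ?H"]) simp_all
  also have "card \<E> = m choose (DIM('a) - 2)"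
    unfolding \<E>_def using n_subsets[OF finH] m by simp
  also have "real (m choose (DIM('a) - 2)) * real m \<le> real (m ^ (DIM('a) - 2)) * real m"
    by (intro mult_right_mono) (simp_all only: of_nat_le_iff binomial_le_power of_nat_0_le_iff)
  also have "\<dots> = real m ^ (Suc (DIM('a) - 2))" by simp
  also have "Suc (DIM('a) - 2) = DIM('a) - 1" using d by simp
  finally show ?thesis .
qed

text \<open>The two families of simplexes are the \<open>d + 1\<close>-subsets of \<open>S \<inter> F\<close> and the good unions \<open>D \<union> P\<close>. Both
  \<open>D\<close> and \<open>P\<close> can be read off from the union by intersecting with \<open>F\<close> and its complement, so no
  simplex is counted twice.\<close>

lemma card_affine_simplexes_rich:
  fixes S :: "'a::euclidean_space set"
  assumes fin: "finite S" and gen: "almost_general S" and d: "DIM('a) \<ge> 2"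
    and F: "affine F" "aff_dim F = int DIM('a) - 1"
    and m: "card (S \<inter> F) = m" and k: "card (S - F) = k"
  shows "real (card {A. A \<subseteq> S \<and> affine_simplex A})
     \<ge> real (m choose (DIM('a) + 1))
         + real (k choose 2) * (real (m choose DIM('a)) - real m ^ (DIM('a) - 1))"
proof -
  let ?d = "DIM('a)"
  let ?H = "S \<inter> F"
  define X where "X = {A. A \<subseteq> ?H \<and> card A = ?d + 1}"
  define \<P> where "\<P> = {P. P \<subseteq> S - F \<and> card P = 2}"
  define good where "good P = {D. D \<subseteq> ?H \<and> card D = ?d \<and> affine_simplex (D \<union> P)}" for P
  let ?bad = "\<lambda>P. {D. D \<subseteq> ?H \<and> card D = ?d \<and> \<not> affine_simplex (D \<union> P)}"
  define Z where "Z = (\<lambda>(P, D). D \<union> P) ` Sigma \<P> good"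
  have finH: "finite ?H" and fin\<P>: "finite \<P>" and finX: "finite X" and fing: "finite (good P)" for P
    using fin by (auto simp: \<P>_def X_def good_def)
  have "affine_simplex A" if "A \<in> X" for A
  proof -
    have A: "A \<subseteq> ?H" "card A = ?d + 1" using that by (auto simp: X_def)
    have "aff_dim A \<le> int ?d - 1"
      using A(1) F(2) aff_dim_subset[of A F] by auto
    then have "affine_dependent A"
      using A(2) affine_independent_iff_card[of A] by auto
    then show ?thesis using affine_simplex_of_card_Suc_DIM[OF gen _ A(2) _ d] A(1) by blast
  qed
  then have "X \<union> Z \<subseteq> {A. A \<subseteq> S \<and> affine_simplex A}"
    by (auto simp: X_def Z_def \<P>_def good_def)
  moreover have "finite {A. A \<subseteq> S \<and> affine_simplex A}" using fin by simp
  ultimately have "card (X \<union> Z) \<le> card {A. A \<subseteq> S \<and> affine_simplex A}"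
    by (rule card_mono[rotated])
  moreover have "finite Z" unfolding Z_def using fin\<P> fing by blast
  moreover have "X \<inter> Z = {}"
  proof -
    have "\<not> D \<union> P \<subseteq> F" if "P \<in> \<P>" for P D
      using that card_eq_0_iff[of P] unfolding \<P>_def by fastforce
    then show ?thesis unfolding X_def Z_def by blast
  qed
  moreover have "card X = m choose (?d + 1)"
    unfolding X_def using n_subsets[OF finH] m by simp
  ultimately have 1: "card {A. A \<subseteq> S \<and> affine_simplex A} \<ge> (m choose (?d + 1)) + card Z"
    using finX by (simp add: card_Un_disjoint)
  have inj: "inj_on (\<lambda>(P, D). D \<union> P) (Sigma \<P> good)"
  proof (rule inj_onI, clarify)
    fix P D P' D' assume *: "P \<in> \<P>" "D \<in> good P" "P' \<in> \<P>" "D' \<in> good P'" "D \<union> P = D' \<union> P'"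
    then have "P = (D \<union> P) - F" "D = (D \<union> P) \<inter> F" "P' = (D' \<union> P') - F" "D' = (D' \<union> P') \<inter> F"
      unfolding \<P>_def good_def by blast+
    then show "P = P' \<and> D = D'" using *(5) by metis
  qed
  have good: "real (card (good P)) \<ge> real (m choose ?d) - real m ^ (?d - 1)" if "P \<in> \<P>" for P
  proof -
    have "card {D. D \<subseteq> ?H \<and> card D = ?d} = m choose ?d"
      using n_subsets[OF finH] m by simp
    moreover have "{D. D \<subseteq> ?H \<and> card D = ?d} = good P \<union> ?bad P"
      unfolding good_def by blast
    ultimately have "m choose ?d \<le> card (good P) + card (?bad P)"
      using card_Un_le[of "good P" "?bad P"] by simp
    moreover have "real (card (?bad P)) \<le> real m ^ (?d - 1)"
      using card_bad_completions[OF fin gen F(1) d _ _ m] that unfolding \<P>_def by blast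
    ultimately show ?thesis by linarith
  qed
  have "card \<P> = k choose 2"
    unfolding \<P>_def using n_subsets[of "S - F" 2] fin k by simp
  then have "real (k choose 2) * (real (m choose ?d) - real m ^ (?d - 1))
        = (\<Sum>P\<in>\<P>. real (m choose ?d) - real m ^ (?d - 1))" by simp
  also have "\<dots> \<le> (\<Sum>P\<in>\<P>. real (card (good P)))"
    using good by (rule sum_mono)
  also have "\<dots> = real (card Z)"
    unfolding Z_def using inj fin\<P> fing by (simp add: card_image card_SigmaI)
  finally show ?thesis using 1 by linarith
qed

section \<open>Comparing the counts\<close>

lemma binomial_Suc_le_add: "(m + k) choose Suc d \<le> (m choose Suc d) + k * (m + k) ^ d"
proof (induction k)
  case (Suc k)
  have "(m + Suc k) choose Suc d = ((m + k) choose d) + ((m + k) choose Suc d)" by simp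
  also have "\<dots> \<le> (m + k) ^ d + ((m choose Suc d) + k * (m + k) ^ d)"
    using Suc binomial_le_power by (rule add_mono[rotated])
  also have "\<dots> = (m choose Suc d) + Suc k * (m + k) ^ d" by simp
  also have "\<dots> \<le> (m choose Suc d) + Suc k * (m + Suc k) ^ d"
    by (intro add_left_mono mult_left_mono power_mono) auto
  finally show ?case .
qed simp

text \<open>The gain \<open>k choose 2\<close> times \<open>(m choose d) - m\<^sup>d\<^sup>-\<^sup>1\<close> against the loss \<open>k n\<^sup>d\<close>. With \<open>a = (e / d)\<^sup>d\<close>
  the second factor is at least \<open>a n\<^sup>d / 2\<close>: the binomial coefficient is at least \<open>(m / d)\<^sup>d \<ge> a n\<^sup>d\<close>, and
  the lower bound on \<open>m\<close> makes \<open>m\<^sup>d\<^sup>-\<^sup>1\<close> at most half of \<open>(m / d)\<^sup>d\<close>. If \<open>k - 1 > 4 / a\<close>, the gain therefore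
  covers the loss; otherwise the loss is at most \<open>(4 / a + 1) n\<^sup>d\<close>.\<close>

lemma rich_count_ge:
  fixes e :: real and d m k :: nat
  assumes d: "d \<ge> 1" and e: "0 < e" and me: "real m \<ge> e * real (m + k)"
    and m: "real m \<ge> 2 * real d ^ d"
  shows "real (m choose (d + 1)) + real (k choose 2) * (real (m choose d) - real m ^ (d - 1))
           \<ge> real ((m + k) choose (d + 1)) - (4 / (e / real d) ^ d + 1) * real (m + k) ^ d"
proof -
  let ?n = "m + k"
  define a where "a = (e / real d) ^ d"
  have a: "a > 0" using d e by (simp add: a_def)
  have md: "real m \<ge> d"
  proof -
    have "real d ^ 1 \<le> real d ^ d" using d by (intro power_increasing) auto
    moreover have "0 \<le> real d ^ d" by simp
    ultimately show ?thesis using m unfolding power_one_right by linarith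
  qed
  have lead: "(real m / real d) ^ d \<le> real (m choose d)"
    using md by (intro binomial_ge_n_over_k_pow_k) simp
  have "2 * real m ^ (d - 1) * real d ^ d \<le> real m * real m ^ (d - 1)"
    using mult_right_mono[OF m, of "real m ^ (d - 1)"] by (simp add: mult_ac)
  also have "\<dots> = real m ^ d" using d by (simp add: power_eq_if)
  finally have "2 * real m ^ (d - 1) \<le> (real m / real d) ^ d"
    using d by (simp add: power_divide field_simps)
  moreover have "a * real ?n ^ d \<le> (real m / real d) ^ d"
  proof -
    have "a * real ?n ^ d = (e * real ?n / real d) ^ d"
      by (simp add: a_def power_mult_distrib power_divide)
    also have "\<dots> \<le> (real m / real d) ^ d"
      using me e by (intro power_mono divide_right_mono) auto
    finally show ?thesis .
  qed
  ultimately have good: "a / 2 * real ?n ^ d \<le> real (m choose d) - real m ^ (d - 1)"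
    using lead by simp
  have "real (?n choose (d + 1)) \<le> real ((m choose Suc d) + k * ?n ^ d)"
    using binomial_Suc_le_add[of m k d] by (simp only: of_nat_le_iff Suc_eq_plus1)
  then have loss: "real (?n choose (d + 1)) \<le> real (m choose (d + 1)) + real k * real ?n ^ d"
    by simp
  have npos: "0 \<le> real ?n ^ d" by simp
  have g0: "0 \<le> real (m choose d) - real m ^ (d - 1)"
    using good a npos by (meson divide_nonneg_pos less_imp_le mult_nonneg_nonneg order_trans zero_less_numeral)
  show ?thesis
  proof (cases "real k \<le> 4 / a + 1")
    case True
    then have "real k * real ?n ^ d \<le> (4 / a + 1) * real ?n ^ d"
      by (intro mult_right_mono) auto
    moreover have "0 \<le> real (k choose 2) * (real (m choose d) - real m ^ (d - 1))"
      using g0 by simp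
    ultimately show ?thesis using loss unfolding a_def by linarith
  next
    case False
    have k2: "real (k choose 2) = real k * (real k - 1) / 2"
    proof -
      have "2 * (k choose 2) = k * (k - 1)"
        unfolding choose_two by (intro dvd_mult_div_cancel) (cases k; simp)
      then have "2 * real (k choose 2) = real k * real (k - 1)"
        by (metis of_nat_mult of_nat_numeral)
      then show ?thesis by (cases k) auto
    qed
    have "real k * (4 / a) / 2 \<le> real (k choose 2)"
      unfolding k2 using False by (intro divide_right_mono mult_left_mono) auto
    then have "(real k * (4 / a) / 2) * (a / 2 * real ?n ^ d)
        \<le> real (k choose 2) * (real (m choose d) - real m ^ (d - 1))"
      using good a by (intro mult_mono) auto
    moreover have "(real k * (4 / a) / 2) * (a / 2 * real ?n ^ d) = real k * real ?n ^ d"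
      using a by simp
    moreover have "0 \<le> (4 / a + 1) * real ?n ^ d" using a by simp
    ultimately show ?thesis using loss unfolding a_def by linarith
  qed
qed

text \<open>The value of \<open>e\<close> is half of the proportion \<open>1 / (d + 2)\<^sup>d\<^sup>+\<^sup>2\<close> in the bound
  \<open>(n choose (d + 2)) \<ge> (n / (d + 2))\<^sup>d\<^sup>+\<^sup>2\<close>, so that at least \<open>e n\<^sup>d\<^sup>+\<^sup>2\<close> simplexes are left in the
  sparse case. The bound on \<open>n\<close> says \<open>e n \<ge> 2 d\<^sup>d\<close>, which is what the rich case asks of \<open>m\<close> and which
  also gives \<open>e n\<^sup>d\<^sup>+\<^sup>2 \<ge> n\<^sup>d\<^sup>+\<^sup>1\<close>.\<close>

lemma card_affine_simplexes_ge:
  fixes S :: "'a::euclidean_space set"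
  defines "d \<equiv> DIM('a)"
  defines "e \<equiv> 1 / (2 * real (d + 2) ^ (d + 2))"
  assumes fin: "finite S" and gen: "almost_general S" and d: "d \<ge> 2" and n: "card S = n"
    and large: "real n \<ge> 4 * real (d + 2) ^ (d + 2) * real d ^ d"
  shows "real (card {A. A \<subseteq> S \<and> affine_simplex A})
           \<ge> real (n choose (d + 1)) - (4 / (e / real d) ^ d + 1) * real n ^ d"
proof -
  have q1: "1 \<le> real (d + 2) ^ (d + 2)" by (rule one_le_power) simp
  have dd1: "1 \<le> real d ^ d" using d by (intro one_le_power) simp
  have e: "0 < e" using q1 by (auto simp: e_def divide_simps)
  have en: "e * real n \<ge> 2 * real d ^ d"
    using large q1 by (simp add: e_def field_simps)
  show ?thesis
  proof (cases "\<exists>D. D \<subseteq> S \<and> card D = d \<and> real (card (S \<inter> affine hull D)) > e * real n")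
    case True
    then obtain D where D: "D \<subseteq> S" "card D = d" and big: "real (card (S \<inter> affine hull D)) > e * real n"
      by blast
    define m where "m = card (S \<inter> affine hull D)"
    define k where "k = card (S - affine hull D)"
    have mk: "m + k = n"
      unfolding m_def k_def using n fin by (metis card_Int_Diff)
    have "\<not> affine_dependent D"
      using D by (intro almost_generalD[OF gen] finite_subset[OF _ fin]) (auto simp: d_def)
    then have "aff_dim (affine hull D) = int d - 1"
      using D(2) by (simp add: affine_independent_iff_card)
    then have "real (card {A. A \<subseteq> S \<and> affine_simplex A})
       \<ge> real (m choose (d + 1)) + real (k choose 2) * (real (m choose d) - real m ^ (d - 1))"
      using card_affine_simplexes_rich[OF fin gen _ affine_affine_hull _ m_def[symmetric] k_def[symmetric]]
        d unfolding d_def by blast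
    moreover have "real m \<ge> e * real (m + k)" using big mk by (simp add: m_def)
    moreover have "real m \<ge> 2 * real d ^ d" using big en by (simp add: m_def)
    ultimately show ?thesis
      using rich_count_ge[of d e m k] d e mk by simp
  next
    case False
    have "real (card {A. A \<subseteq> S \<and> affine_simplex A})
        \<ge> real (n choose (d + 2)) - e * real n ^ (d + 2)"
      unfolding d_def using False e
      by (intro card_affine_simplexes_sparse[OF fin n]) (auto simp: d_def not_less)
    moreover have "2 * e * real n ^ (d + 2) \<le> real (n choose (d + 2))"
    proof -
      have "real (d + 2) ^ 1 \<le> real (d + 2) ^ (d + 2)" by (intro power_increasing) auto
      also have "\<dots> \<le> 4 * real (d + 2) ^ (d + 2) * real d ^ d"
        using mult_mono[OF order_refl dd1, of "4 * real (d + 2) ^ (d + 2)"] q1 by simp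
      finally have "real (d + 2) \<le> real n"
        using large unfolding power_one_right by (rule order_trans)
      then have "d + 2 \<le> n" by (simp only: of_nat_le_iff)
      then have "(real n / real (d + 2)) ^ (d + 2) \<le> real (n choose (d + 2))"
        by (rule binomial_ge_n_over_k_pow_k)
      then show ?thesis by (simp add: e_def power_divide)
    qed
    moreover have "real (n choose (d + 1)) \<le> e * real n ^ (d + 2)"
    proof -
      have "real (n choose (d + 1)) \<le> 1 * real n ^ (d + 1)"
        using binomial_le_power[of n "d + 1"] by (simp only: mult_1 of_nat_le_iff flip: of_nat_power)
      also have "\<dots> \<le> (e * real n) * real n ^ (d + 1)"
        using en dd1 by (intro mult_right_mono) auto
      finally show ?thesis by (simp add: mult_ac)
    qed
    moreover have "0 \<le> (4 / (e / real d) ^ d + 1) * real n ^ d" using e by simp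
    ultimately show ?thesis by linarith
  qed
qed

theorem theorem3:
  fixes d :: nat
  assumes "d \<ge> 3" and "CARD('n::finite) = d"
  shows "\<exists>c::real. \<forall>(n::nat) (S :: (real ^ 'n) set).
           finite S \<and> card S = n \<and>
           (\<forall>T. T \<subseteq> S \<and> card T = d \<longrightarrow> \<not> on_flat (int d - 2) T) \<longrightarrow>
           real (card {A. A \<subseteq> S \<and> affine_simplex A}) \<ge> real (n choose (d + 1)) - c * real n ^ d"
proof -
  have dim: "DIM(real ^ 'n) = d" using assms(2) by simp
  define n0 where "n0 = 4 * real (d + 2) ^ (d + 2) * real d ^ d"
  define e where "e = 1 / (2 * real (d + 2) ^ (d + 2))"
  define K where "K = 4 / (e / real d) ^ d + 1"
  have K: "0 \<le> K" and n0: "0 \<le> n0" by (auto simp: K_def e_def n0_def)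
  show ?thesis
  proof (intro exI[of _ "K + n0"] allI impI, elim conjE)
    fix n :: nat and S :: "(real ^ 'n) set"
    assume fin: "finite S" and n: "card S = n"
      and flat: "\<forall>T. T \<subseteq> S \<and> card T = d \<longrightarrow> \<not> on_flat (int d - 2) T"
    show "real (card {A. A \<subseteq> S \<and> affine_simplex A}) \<ge> real (n choose (d + 1)) - (K + n0) * real n ^ d"
    \<comment> \<open>For \<open>n < n0\<close> the bound is trivial: \<open>n choose (d + 1)\<close> is at most \<open>n\<^sup>d\<^sup>+\<^sup>1 \<le> n0 n\<^sup>d\<close>.\<close>
    proof (cases "real n \<ge> n0")
      case True
      have "1 * real d ^ 1 \<le> (4 * real (d + 2) ^ (d + 2)) * real d ^ d"
      proof (intro mult_mono power_increasing)
        show "1 \<le> 4 * real (d + 2) ^ (d + 2)"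
          using one_le_power[of "real (d + 2)" "d + 2"] by simp
      qed (use assms(1) in auto)
      then have "d \<le> n" using True by (simp add: n0_def)
      then have "almost_general S"
        using fin n flat dim by (intro almost_general_of_not_on_flat) auto
      then have "real (card {A. A \<subseteq> S \<and> affine_simplex A}) \<ge> real (n choose (d + 1)) - K * real n ^ d"
        using card_affine_simplexes_ge[OF fin _ _ n] True assms(1)
        unfolding dim K_def e_def n0_def by simp
      moreover have "0 \<le> n0 * real n ^ d" using n0 by simp
      ultimately show ?thesis by (simp add: algebra_simps)
    next
      case False
      have "real (n choose (d + 1)) \<le> real n * real n ^ d"
        using binomial_le_power[of n "d + 1"] by (simp flip: of_nat_power of_nat_mult)
      also have "\<dots> \<le> (K + n0) * real n ^ d"
        using False K by (intro mult_right_mono) auto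
      finally show ?thesis by simp
    qed
  qed
qed

end
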